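(* Let $X$ be a complex Banach space, $\mathcal D\subset\mathcal D_e\subset X$ two not necessarily dense linear subspaces, and $T:\mathcal D\to X$, $T_e:\mathcal D_e\to X$ two linear operators, not necessarily bounded or closed, with $T_e$ extending $T$. Let $\Lambda$ be a non-empty set and, for each $\lambda\in\Lambda$, let $L_\lambda$ be a complex normed space. Suppose that there exist a linear map $\mathcal F:X\to\prod_{\lambda\in\Lambda}L_\lambda$, injective on $\mathcal D_e$, and a map $\varepsilon:\Lambda\to\mathbb C$, such that $\mathcal F(T_ex)(\lambda)=\varepsilon(\lambda)\,\mathcal Fx(\lambda)$ for all $\lambda\in\Lambda$ and all $x\in\mathcal D_e$. Suppose furthermore that: (A1) for each $\lambda\in\Lambda$, the map $x\mapsto\mathcal Fx(\lambda)$ is continuous on $\mathcal D_e$ in the topology induced by $X$; (A2) there exists a family $(G_\lambda)_{\lambda\in\Lambda}$ of not necessarily bounded linear maps $G_\lambda:L_\lambda\to\mathcal D$ such that, for all $x\in\mathcal D$, the series $\sum_{\lambda\in\Lambda}G_\lambda(\mathcal Fx(\lambda))$ converges absolutely in $X$, with sum equal to $x$. If $x\in\mathcal D(T^\infty)$, then the limit $\lim_{n\to\infty}\|T_e^nx\|^{1/n}$ exists in the extended positive real numbers $[0,\infty]$ and $$\lim_{n\to\infty}\|T_e^nx\|^{1/n}=\sup\left\{|z| : z\in\left[\varepsilon(\operatorname{supp}\mathcal Fx)\right]^{\mathrm{cl}}\right\}.$$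
   Context: For $s\in\prod_{\lambda\in\Lambda}L_\lambda$, $s(\lambda)$ denotes the $\lambda$-th coordinate of $s$, and $\operatorname{supp}s=\{\lambda\in\Lambda : s(\lambda)\neq0\}$. For $A\subset\mathbb C$, $A^{\mathrm{cl}}$ is its closure. The supremum of an empty set of real numbers is $0$ by convention. $\mathcal D(T^\infty)=\bigcap_{n=0}^\infty\mathcal D(T^n)$, where $\mathcal D(T^n)$ is the natural domain of $T^n$; that is, $x\in\mathcal D(T^\infty)$ iff $x\in\mathcal D$ and $T^nx$ is defined and lies in $\mathcal D$ for all $n$. *)

theory Defs
  imports "HOL-Analysis.Analysis"
begin

class complex_vector = ab_group_add +
  fixes scaleC :: "complex \<Rightarrow> 'a \<Rightarrow> 'a"  (infixr "*\<^sub>C" 75)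
  assumes scaleC_add_right: "a *\<^sub>C (x + y) = a *\<^sub>C x + a *\<^sub>C y"
    and scaleC_add_left: "(a + b) *\<^sub>C x = a *\<^sub>C x + b *\<^sub>C x"
    and scaleC_scaleC: "a *\<^sub>C b *\<^sub>C x = (a * b) *\<^sub>C x"
    and scaleC_one: "1 *\<^sub>C x = x"

global_interpretation complex_vector:
  vector_space "scaleC :: complex \<Rightarrow> 'a \<Rightarrow> 'a :: complex_vector"
  defines csubspace = complex_vector.subspace
  by standard (simp_all add: scaleC_add_right scaleC_add_left scaleC_scaleC scaleC_one)

class complex_banach = complex_vector + banach +
  assumes scaleR_scaleC: "r *\<^sub>R x = complex_of_real r *\<^sub>C x"
    and norm_scaleC: "norm (a *\<^sub>C x) = cmod a * norm x"

instantiation complex :: complex_banach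
begin

definition scaleC_complex :: "complex \<Rightarrow> complex \<Rightarrow> complex" where
  "scaleC_complex = (*)"

instance
  by standard (simp_all add: scaleC_complex_def algebra_simps scaleR_conv_of_real norm_mult)

end

definition clinear_on ::
    "'a::complex_vector set \<Rightarrow> ('a \<Rightarrow> 'b::complex_vector) \<Rightarrow> bool" where
  "clinear_on S f \<longleftrightarrow>
     (\<forall>u\<in>S. \<forall>v\<in>S. f (u + v) = f u + f v) \<and> (\<forall>c. \<forall>u\<in>S. f (c *\<^sub>C u) = c *\<^sub>C f u)"

(* A complex normed space is represented by a linear subspace S of an ambient complex vector
   space, which itself carries no norm, together with a norm N on S; the values of N outside S
   are irrelevant.  Families of such pairs in one ambient space cover arbitrary families of
   complex normed spaces: take the algebraic direct sum as ambient space. *)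
definition cnormed_space :: "'a::complex_vector set \<Rightarrow> ('a \<Rightarrow> real) \<Rightarrow> bool" where
  "cnormed_space S N \<longleftrightarrow>
     csubspace S \<and>
     (\<forall>u\<in>S. 0 \<le> N u) \<and>
     (\<forall>u\<in>S. N u = 0 \<longleftrightarrow> u = 0) \<and>
     (\<forall>u\<in>S. \<forall>v\<in>S. N (u + v) \<le> N u + N v) \<and>
     (\<forall>c. \<forall>u\<in>S. N (c *\<^sub>C u) = cmod c * N u)"

(* Metric_space requires nonnegativity and symmetry also off the carrier, hence the truncation. *)
definition norm_dist :: "'a::complex_vector set \<Rightarrow> ('a \<Rightarrow> real) \<Rightarrow> 'a \<Rightarrow> 'a \<Rightarrow> real" where
  "norm_dist S N u v = (if u \<in> S \<and> v \<in> S then N (u - v) else 0)"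

definition norm_topology :: "'a::complex_vector set \<Rightarrow> ('a \<Rightarrow> real) \<Rightarrow> 'a topology" where
  "norm_topology S N = Metric_space.mtopology S (norm_dist S N)"

lemma Metric_space_norm_dist:
  assumes "cnormed_space S N"
  shows "Metric_space S (norm_dist S N)"
proof -
  have sub: "csubspace S" and nonneg: "\<And>u. u \<in> S \<Longrightarrow> 0 \<le> N u"
    and zero: "\<And>u. u \<in> S \<Longrightarrow> N u = 0 \<longleftrightarrow> u = 0"
    and tri: "\<And>u v. u \<in> S \<Longrightarrow> v \<in> S \<Longrightarrow> N (u + v) \<le> N u + N v"
    and hom: "\<And>c u. u \<in> S \<Longrightarrow> N (c *\<^sub>C u) = cmod c * N u"
    using assms by (simp_all add: cnormed_space_def)
  have diff: "u - v \<in> S" if "u \<in> S" "v \<in> S" for u v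
    using complex_vector.subspace_diff[OF sub that] .
  have sym: "N (u - v) = N (v - u)" if "u \<in> S" "v \<in> S" for u v
    using hom[OF diff[OF that(2,1)], of "-1"] by simp
  have "N (u - w) \<le> N (u - v) + N (v - w)" if "u \<in> S" "v \<in> S" "w \<in> S" for u v w
    using tri[OF diff diff, of u v v w] that by simp
  then show ?thesis
    by unfold_locales (auto simp: norm_dist_def nonneg diff sym zero)
qed

(* An operator T : D \<rightarrow> X is represented by a total function whose values off D are irrelevant.
   On dom_pow D T n the total iterate T ^^ n agrees with the partial one. *)
primrec dom_pow :: "'a set \<Rightarrow> ('a \<Rightarrow> 'a) \<Rightarrow> nat \<Rightarrow> 'a set" where
  "dom_pow D T 0 = UNIV"
| "dom_pow D T (Suc n) = {x \<in> dom_pow D T n. (T ^^ n) x \<in> D}"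

definition dom_infty :: "'a set \<Rightarrow> ('a \<Rightarrow> 'a) \<Rightarrow> 'a set" where
  "dom_infty D T = (\<Inter>n. dom_pow D T n)"

lemma dom_infty_iff: "x \<in> dom_infty D T \<longleftrightarrow> (\<forall>n. (T ^^ n) x \<in> D)"
proof -
  have "x \<in> dom_pow D T n \<longleftrightarrow> (\<forall>k<n. (T ^^ k) x \<in> D)" for n
    by (induction n) (auto simp: less_Suc_eq)
  then show ?thesis
    by (auto simp: dom_infty_def)
qed

definition supp_on :: "'i set \<Rightarrow> ('i \<Rightarrow> 'b::zero) \<Rightarrow> 'i set" where
  "supp_on I s = {i \<in> I. s i \<noteq> 0}"

end

theory Submission
  imports Defs
begin

text \<open>Write \<open>x n\<close> for the \<open>n\<close>-th iterate of \<open>x\<close>. All iterates stay in \<open>D\<close>, and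
  \<open>F\<close> turns the operator into multiplication, so \<open>F (x n) i = \<epsilon> i ^ n *\<^sub>C F x i\<close>. Growth
  of the norms of \<open>x n\<close> is therefore controlled from both sides.

  From below, a coordinate map that is continuous and linear on \<open>De\<close> is bounded there. At an
  \<open>i\<close> in the support this gives \<open>c * cmod (\<epsilon> i) ^ n \<le> norm (x n)\<close> with \<open>c > 0\<close>
  independent of \<open>n\<close>.

  From above, if \<open>r\<close> bounds \<open>cmod \<circ> \<epsilon>\<close> on the support, synthesizing \<open>x n\<close> from
  its coordinates gives \<open>x n = (\<Sum>i. \<epsilon> i ^ n *\<^sub>C G i (F x i))\<close>, hence
  \<open>norm (x n) \<le> C * r ^ n\<close> with \<open>C = (\<Sum>i. norm (G i (F x i)))\<close>. One
  constant, taken from the absolute convergence at \<open>x\<close>, thus serves all iterates at once.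

  Taking \<open>n\<close>-th roots removes the constants (lemma \<open>tendsto_root_SUP_norm\<close>), and passing
  to the closure of the values of \<open>\<epsilon>\<close> does not change the supremum of the moduli.\<close>

lemma SUP_closure_continuous:
  fixes f :: "'a::topological_space \<Rightarrow> 'b::{complete_linorder, linorder_topology}"
  assumes "continuous_on UNIV f"
  shows "(SUP z\<in>closure A. f z) = (SUP z\<in>A. f z)"
proof (rule antisym)
  have "closed {z. f z \<le> (SUP z\<in>A. f z)}"
    using assms by (intro closed_Collect_le continuous_on_const)
  then have "closure A \<subseteq> {z. f z \<le> (SUP z\<in>A. f z)}"
    by (intro closure_minimal) (auto intro: SUP_upper)
  then show "(SUP z\<in>closure A. f z) \<le> (SUP z\<in>A. f z)"
    by (auto intro: SUP_least)
qed (intro SUP_subset_mono closure_subset order_refl)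

text \<open>Exponential bounds on both sides determine the growth rate, since the \<open>n\<close>-th roots of
  positive constants tend to 1. If the supremum is infinite, there is no
  admissible \<open>r\<close> and the lower bounds alone force divergence.\<close>

lemma tendsto_root_SUP_norm:
  fixes b :: "nat \<Rightarrow> real" and e :: "'i \<Rightarrow> 'a::real_normed_vector"
  assumes lower: "\<And>i. i \<in> I \<Longrightarrow> \<exists>c>0. \<forall>n. c * norm (e i) ^ n \<le> b n"
    and upper: "\<And>r. 0 \<le> r \<Longrightarrow> (\<And>i. i \<in> I \<Longrightarrow> norm (e i) \<le> r) \<Longrightarrow>
                  \<exists>C. \<forall>n. b n \<le> C * r ^ n"
  shows "(\<lambda>n. ennreal (root n (b n))) \<longlonglongrightarrow> (SUP i\<in>I. ennreal (norm (e i)))"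
    (is "_ \<longlonglongrightarrow> ?S")
proof (rule order_tendstoI)
  have lim: "(\<lambda>n. ennreal (root n c * r)) \<longlonglongrightarrow> ennreal r" if "c > 0" for c r :: real
  proof -
    have "(\<lambda>n. root n c * r) \<longlonglongrightarrow> 1 * r"
      by (intro tendsto_intros LIMSEQ_root_const that)
    then show ?thesis
      by (intro tendsto_ennrealI) simp
  qed
  have root: "root n (c * r ^ n) = root n c * r" if "n > 0" "0 \<le> r" for n and c r :: real
    using that by (simp add: real_root_mult real_root_power_cancel)
  fix a
  {
    assume "a < ?S"
    then obtain i where i: "i \<in> I" "a < ennreal (norm (e i))"
      by (auto simp: less_SUP_iff)
    obtain c where c: "c > 0" "\<And>n. c * norm (e i) ^ n \<le> b n"
      using lower[OF i(1)] by blast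
    have "\<forall>\<^sub>F n in sequentially. a < ennreal (root n c * norm (e i))"
      using order_tendstoD(1)[OF lim[OF c(1)] i(2)] .
    then show "\<forall>\<^sub>F n in sequentially. a < ennreal (root n (b n))"
      using eventually_gt_at_top[of 0]
    proof eventually_elim
      case (elim n)
      have "root n c * norm (e i) \<le> root n (b n)"
        using real_root_le_mono[OF elim(2) c(2)[of n]] by (simp add: root[OF elim(2)])
      then show ?case
        using elim(1) by (meson ennreal_leI less_le_trans)
    qed
  }
  {
    assume a: "?S < a"
    define r where "r = enn2real ?S"
    have S: "?S = ennreal r"
      using less_le_trans[OF a top_greatest] unfolding r_def by (rule ennreal_enn2real[symmetric])
    have r: "0 \<le> r"
      by (simp add: r_def)
    have "norm (e i) \<le> r" if "i \<in> I" for i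
      using SUP_upper[OF that, of "\<lambda>i. ennreal (norm (e i))"] r unfolding S by simp
    then obtain C where C: "\<And>n. b n \<le> C * r ^ n"
      using upper[OF r] by blast
    \<comment> \<open>The upper bound may come with \<open>C \<le> 0\<close>, whose roots do not tend to 1.\<close>
    define C' where "C' = max C 1"
    have C': "C' > 0" "b n \<le> C' * r ^ n" for n
      using C[of n] mult_right_mono[of C C' "r ^ n"] r by (auto simp: C'_def)
    have "\<forall>\<^sub>F n in sequentially. ennreal (root n C' * r) < a"
      using order_tendstoD(2)[OF lim[OF C'(1)]] a unfolding S by blast
    then show "\<forall>\<^sub>F n in sequentially. ennreal (root n (b n)) < a"
      using eventually_gt_at_top[of 0]
    proof eventually_elim
      case (elim n)
      have "root n (b n) \<le> root n C' * r"
        using real_root_le_mono[OF elim(2) C'(2)[of n]] by (simp add: root[OF elim(2) r])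
      then show ?case
        using elim(1) by (meson ennreal_leI le_less_trans)
    qed
  }
qed

lemma clinear_on_scaleC: "clinear_on S f \<Longrightarrow> u \<in> S \<Longrightarrow> f (c *\<^sub>C u) = c *\<^sub>C f u"
  by (simp add: clinear_on_def)

text \<open>Boundedness by rescaling: some ball around 0 is mapped into the
  unit ball, and every vector can be rescaled into it.\<close>

lemma continuous_linear_on_imp_bounded:
  fixes f :: "'x::complex_banach \<Rightarrow> 'l::complex_vector"
  assumes V: "csubspace V" and S: "cnormed_space S M" and lin: "clinear_on V f"
    and range: "f ` V \<subseteq> S"
    and cont: "continuous_map (top_of_set V) (norm_topology S M) f"
  shows "\<exists>B>0. \<forall>y\<in>V. M (f y) \<le> B * norm y"
proof -
  interpret S: Metric_space S "norm_dist S M"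
    using S by (rule Metric_space_norm_dist)
  have V0: "0 \<in> V"
    using V by (rule complex_vector.subspace_0)
  have S0: "0 \<in> S"
    using S by (auto simp: cnormed_space_def intro: complex_vector.subspace_0)
  note hom = clinear_on_scaleC[OF lin]
  have f0: "f 0 = 0"
    using hom[OF V0, of 0] by simp
  have M: "M (c *\<^sub>C u) = cmod c * M u" if "u \<in> S" for c u
    using S that by (simp add: cnormed_space_def)
  have M0: "M 0 = 0"
    using M[OF S0, of 0] by simp
  have dist0: "norm_dist S M 0 u = M u" if "u \<in> S" for u
    using M[OF that, of "-1"] S0 that by (simp add: norm_dist_def)
  have "openin (top_of_set V) {y \<in> V. f y \<in> S.mball 0 1}"
    using openin_continuous_map_preimage[OF cont[unfolded norm_topology_def] S.openin_mball, of 0 1]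
    by simp
  moreover have "0 \<in> {y \<in> V. f y \<in> S.mball 0 1}"
    using V0 S0 M0 by (simp add: f0 dist0)
  ultimately obtain d where d: "d > 0"
    and ball: "\<And>y. y \<in> V \<Longrightarrow> norm y < d \<Longrightarrow> f y \<in> S.mball 0 1"
    unfolding openin_euclidean_subtopology_iff by (auto simp: dist_norm)
  have "M (f y) \<le> 2 / d * norm y" if y: "y \<in> V" for y
  proof (cases "y = 0")
    case True
    then show ?thesis by (simp add: f0 M0)
  next
    case False
    define c where "c = d / (2 * norm y)"
    have c: "c > 0" "c * norm y < d"
      using d False by (simp_all add: c_def)
    have cy: "complex_of_real c *\<^sub>C y \<in> V"
      using V y by (rule complex_vector.subspace_scale)
    have fy: "f y \<in> S"
      using range y by blast
    have "f (complex_of_real c *\<^sub>C y) \<in> S.mball 0 1"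
      using cy c by (intro ball) (simp_all add: norm_scaleC)
    then have "M (f (complex_of_real c *\<^sub>C y)) < 1"
      using dist0 by auto
    then have "c * M (f y) < 1"
      using c by (simp add: hom[OF y] M[OF fy])
    then show ?thesis
      using d False by (simp add: c_def field_simps)
  qed
  then show ?thesis
    using d by (intro exI[of _ "2 / d"]) simp
qed

theorem theorem2p4:
  fixes D De :: "'x::complex_banach set"
    and T Te :: "'x \<Rightarrow> 'x"
    and \<Lambda> :: "'i set"
    and L :: "'i \<Rightarrow> 'l::complex_vector set"
    and N :: "'i \<Rightarrow> 'l \<Rightarrow> real"
    and F :: "'x \<Rightarrow> 'i \<Rightarrow> 'l"
    and \<epsilon> :: "'i \<Rightarrow> complex"
    and x :: 'x
  assumes "csubspace D" and "csubspace De" and "D \<subseteq> De"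
    and "clinear_on D T" and "clinear_on De Te"
    and "\<And>y. y \<in> D \<Longrightarrow> Te y = T y"
    and "\<Lambda> \<noteq> {}"
    and "\<And>i. i \<in> \<Lambda> \<Longrightarrow> cnormed_space (L i) (N i)"
    and "F \<in> UNIV \<rightarrow> (\<Pi>\<^sub>E i\<in>\<Lambda>. L i)"
    and "\<And>i. i \<in> \<Lambda> \<Longrightarrow> clinear_on UNIV (\<lambda>y. F y i)"
    and "inj_on F De"
    and "\<And>i y. i \<in> \<Lambda> \<Longrightarrow> y \<in> De \<Longrightarrow> F (Te y) i = \<epsilon> i *\<^sub>C F y i"
    and A1: "\<And>i. i \<in> \<Lambda> \<Longrightarrow>
        continuous_map (top_of_set De) (norm_topology (L i) (N i)) (\<lambda>y. F y i)"
    and A2: "\<exists>G :: 'i \<Rightarrow> 'l \<Rightarrow> 'x.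
        (\<forall>i\<in>\<Lambda>. clinear_on (L i) (G i) \<and> G i ` L i \<subseteq> D) \<and>
        (\<forall>y\<in>D. (\<lambda>i. norm (G i (F y i))) summable_on \<Lambda> \<and>
               ((\<lambda>i. G i (F y i)) has_sum y) \<Lambda>)"
    and "x \<in> dom_infty D T"
  shows "(\<lambda>n. ennreal (root n (norm ((Te ^^ n) x))))
           \<longlonglongrightarrow> (SUP z \<in> closure (\<epsilon> ` supp_on \<Lambda> (F x)). ennreal (cmod z))"
proof -
  have FL: "F y i \<in> L i" if "i \<in> \<Lambda>" for y i
    using assms(9) that by (auto simp: PiE_iff Pi_iff)
  have TD: "(T ^^ n) x \<in> D" for n
    using assms(15) by (simp add: dom_infty_iff)
  have "(Te ^^ n) x = (T ^^ n) x" for n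
    by (induction n) (simp_all add: assms(6) TD)
  then have xD: "(Te ^^ n) x \<in> D" for n
    by (simp add: TD)
  have F_iterate: "F ((Te ^^ n) x) i = \<epsilon> i ^ n *\<^sub>C F x i" if "i \<in> \<Lambda>" for n i
    by (induction n)
      (use that xD assms(3) in \<open>auto simp: assms(12) scaleC_one scaleC_scaleC subset_iff\<close>)

  have lower: "\<exists>c>0. \<forall>n. c * cmod (\<epsilon> i) ^ n \<le> norm ((Te ^^ n) x)"
    if i: "i \<in> supp_on \<Lambda> (F x)" for i
  proof -
    from i have i\<Lambda>: "i \<in> \<Lambda>" and Fx: "F x i \<noteq> 0"
      by (auto simp: supp_on_def)
    have "clinear_on De (\<lambda>y. F y i)"
      using assms(10)[OF i\<Lambda>] by (auto simp: clinear_on_def)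
    then obtain B where B: "B > 0" "\<And>y. y \<in> De \<Longrightarrow> N i (F y i) \<le> B * norm y"
      using continuous_linear_on_imp_bounded[OF assms(2) assms(8)[OF i\<Lambda>] _ _ A1[OF i\<Lambda>]] FL[OF i\<Lambda>]
      by (auto simp: image_subset_iff)
    have norm: "0 < N i (F x i)" "N i (a *\<^sub>C F x i) = cmod a * N i (F x i)" for a
      using assms(8)[OF i\<Lambda>] FL[OF i\<Lambda>, of x] Fx by (auto simp: cnormed_space_def less_le)
    have "N i (F x i) / B * cmod (\<epsilon> i) ^ n \<le> norm ((Te ^^ n) x)" for n
      using B(2)[of "(Te ^^ n) x"] xD[of n] assms(3) B(1)
      by (auto simp: F_iterate[OF i\<Lambda>] norm norm_power field_simps)
    then show ?thesis
      using norm(1) B(1) by (intro exI[of _ "N i (F x i) / B"]) simp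
  qed

  obtain G where G_lin: "\<And>i. i \<in> \<Lambda> \<Longrightarrow> clinear_on (L i) (G i)"
    and G_summable: "\<And>y. y \<in> D \<Longrightarrow> (\<lambda>i. norm (G i (F y i))) summable_on \<Lambda>"
    and G_sum: "\<And>y. y \<in> D \<Longrightarrow> ((\<lambda>i. G i (F y i)) has_sum y) \<Lambda>"
    using A2 by blast
  have G0: "G i 0 = 0" if "i \<in> \<Lambda>" for i
    using clinear_on_scaleC[OF G_lin[OF that] FL[OF that], of 0] by simp
  have G_iterate: "G i (F ((Te ^^ n) x) i) = \<epsilon> i ^ n *\<^sub>C G i (F x i)" if "i \<in> \<Lambda>" for n i
    using clinear_on_scaleC[OF G_lin[OF that] FL[OF that]] by (simp add: F_iterate[OF that])

  have upper: "\<exists>C. \<forall>n. norm ((Te ^^ n) x) \<le> C * r ^ n"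
    if r: "0 \<le> r" "\<And>i. i \<in> supp_on \<Lambda> (F x) \<Longrightarrow> cmod (\<epsilon> i) \<le> r" for r
  proof (intro exI allI)
    fix n
    \<comment> \<open>Off the support \<open>r\<close> says nothing about \<open>\<epsilon> i\<close>, but there the term vanishes.\<close>
    have bound: "norm (G i (F ((Te ^^ n) x) i)) \<le> norm (G i (F x i)) * r ^ n" if "i \<in> \<Lambda>" for i
    proof (cases "F x i = 0")
      case True
      then show ?thesis
        using that by (simp add: G_iterate G0 norm_scaleC)
    next
      case False
      then have "cmod (\<epsilon> i) ^ n \<le> r ^ n"
        using that r(2) by (intro power_mono) (auto simp: supp_on_def)
      then show ?thesis
        using that by (simp add: G_iterate norm_scaleC norm_power mult.commute mult_right_mono)
    qed
    have "norm ((Te ^^ n) x) = norm (\<Sum>\<^sub>\<infinity>i\<in>\<Lambda>. G i (F ((Te ^^ n) x) i))"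
      by (simp add: infsumI[OF G_sum[OF xD]])
    also have "\<dots> \<le> (\<Sum>\<^sub>\<infinity>i\<in>\<Lambda>. norm (G i (F ((Te ^^ n) x) i)))"
      using G_summable[OF xD] by (rule norm_infsum_bound)
    also have "\<dots> \<le> (\<Sum>\<^sub>\<infinity>i\<in>\<Lambda>. norm (G i (F x i)) * r ^ n)"
      using G_summable[OF xD] G_summable[OF xD[of 0]] bound
      by (intro infsum_mono summable_on_cmult_left) simp_all
    also have "\<dots> = (\<Sum>\<^sub>\<infinity>i\<in>\<Lambda>. norm (G i (F x i))) * r ^ n"
      using G_summable[OF xD[of 0]] by (intro infsum_cmult_left) simp
    finally show "norm ((Te ^^ n) x) \<le> (\<Sum>\<^sub>\<infinity>i\<in>\<Lambda>. norm (G i (F x i))) * r ^ n" .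
  qed

  have "continuous_on UNIV (\<lambda>z. ennreal (cmod z))"
    by (intro continuous_on_ennreal continuous_intros)
  then have "(SUP z \<in> closure (\<epsilon> ` supp_on \<Lambda> (F x)). ennreal (cmod z))
      = (SUP i \<in> supp_on \<Lambda> (F x). ennreal (cmod (\<epsilon> i)))"
    by (simp add: SUP_closure_continuous image_image)
  then show ?thesis
    using tendsto_root_SUP_norm[where e = \<epsilon>, OF lower upper] by simp
qed

end
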